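(* Let $K\ge 1$ be an integer, $N_0>0$, $r^*\ge 0$, and let $h_1,\dots,h_K$ be nonzero complex numbers with $|h_1|\ge |h_2|\ge\dots\ge|h_K|$. Define $$P_N^* = (e^{r^*}-1)N_0\sum_{i=0}^{K-1}\frac{e^{ir^*}}{|h_{K-i}|^2},\qquad P_{O1}^* = (e^{Kr^*}-1)\frac{N_0}{K}\sum_{i=1}^{K}\frac{1}{|h_i|^2},$$ $$P_{O2}^* = \min_{\alpha_1,\dots,\alpha_K>0,\ \sum_{i=1}^K\alpha_i=1} N_0\sum_{i=1}^{K}\frac{(e^{r^*/\alpha_i}-1)\alpha_i}{|h_i|^2}.$$ Then $$P_N^*\le P_{O2}^*\le P_{O1}^*.$$
   Context: $P_N^*$, $P_{O1}^*$, $P_{O2}^*$ are the minimum total powers required by NOMA, OMA-TYPE-I and OMA-TYPE-II respectively to give each of $K$ users (channel coefficients $h_i$, noise power $N_0$) rate at least $r^*$; only the displayed formulas are needed. *)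

theory Defs
  imports "HOL-Analysis.Analysis"
begin

text \<open>Users are numbered \<open>1, \<dots>, K\<close>; the values of \<open>h\<close> and \<open>\<alpha>\<close> outside \<open>{1..K}\<close> are irrelevant.\<close>

definition noma_power :: "nat \<Rightarrow> real \<Rightarrow> real \<Rightarrow> (nat \<Rightarrow> complex) \<Rightarrow> real" where
  "noma_power K N0 r h =
     (exp r - 1) * N0 * (\<Sum>i=0..K-1. exp (real i * r) / (cmod (h (K - i)))\<^sup>2)"

definition oma1_power :: "nat \<Rightarrow> real \<Rightarrow> real \<Rightarrow> (nat \<Rightarrow> complex) \<Rightarrow> real" where
  "oma1_power K N0 r h =
     (exp (real K * r) - 1) * (N0 / real K) * (\<Sum>i=1..K. 1 / (cmod (h i))\<^sup>2)"

definition oma2_allocation :: "nat \<Rightarrow> (nat \<Rightarrow> real) \<Rightarrow> bool" where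
  "oma2_allocation K \<alpha> \<longleftrightarrow> (\<forall>i\<in>{1..K}. \<alpha> i > 0) \<and> (\<Sum>i=1..K. \<alpha> i) = 1"

definition oma2_objective :: "nat \<Rightarrow> real \<Rightarrow> real \<Rightarrow> (nat \<Rightarrow> complex) \<Rightarrow> (nat \<Rightarrow> real) \<Rightarrow> real" where
  "oma2_objective K N0 r h \<alpha> =
     N0 * (\<Sum>i=1..K. (exp (r / \<alpha> i) - 1) * \<alpha> i / (cmod (h i))\<^sup>2)"

text \<open>The minimum of an infinite set of reals, hence \<open>LEAST\<close> rather than \<open>Min\<close>. The value is
  meaningful only if the minimum is attained, which has to be established separately.\<close>

definition oma2_power :: "nat \<Rightarrow> real \<Rightarrow> real \<Rightarrow> (nat \<Rightarrow> complex) \<Rightarrow> real" where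
  "oma2_power K N0 r h = (LEAST P. P \<in> oma2_objective K N0 r h ` {\<alpha>. oma2_allocation K \<alpha>})"

end

theory Submission
  imports Defs
begin

text \<open>
  Both \<open>P\<^sub>N\<close> and the objective of \<open>P\<^sub>O\<^sub>2\<close> are linear in the nondecreasing weights \<open>1 / |h\<^sub>i|\<^sup>2\<close>, so by
  Abel summation it suffices to compare the tail sums of their coefficients. On the NOMA side the
  tail over the last \<open>n\<close> users telescopes to \<open>e\<^sup>n\<^sup>r - 1\<close>; on the OMA side Jensen's inequality for \<open>exp\<close>
  with weights \<open>\<alpha>\<^sub>i\<close> (and the missing mass placed at \<open>0\<close>) bounds it below by the same number.
  The upper bound is the uniform allocation. The minimum is attained because for \<open>r > 0\<close> the
  objective blows up as some \<open>\<alpha>\<^sub>i\<close> tends to \<open>0\<close>, which confines the problem to a compact set.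
\<close>

section \<open>Coefficient tails and Abel summation\<close>

lemma exp_above_tangent:
  fixes x y :: real
  shows "exp y * (1 + x - y) \<le> exp x"
proof -
  have "exp y * (1 + (x - y)) \<le> exp y * exp (x - y)"
    by (intro mult_left_mono exp_ge_add_one_self) auto
  then show ?thesis
    by (simp add: exp_diff algebra_simps)
qed

text \<open>Jensen via the tangent of \<open>exp\<close> at \<open>y = card I * r\<close>. This
  \<open>y\<close> is the mean of the points \<open>r / \<alpha> i\<close> with weights
  \<open>\<alpha> i\<close> and of the point 0 with weight \<open>1 - S\<close>, so the linear terms
  cancel on averaging.\<close>

lemma exp_minus_one_le_oma2_sum:
  fixes \<alpha> :: "'a \<Rightarrow> real"
  assumes "finite I" and pos: "\<And>i. i \<in> I \<Longrightarrow> \<alpha> i > 0" and "sum \<alpha> I \<le> 1"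
  shows "exp (real (card I) * r) - 1 \<le> (\<Sum>i\<in>I. (exp (r / \<alpha> i) - 1) * \<alpha> i)"
proof -
  define S where "S = sum \<alpha> I"
  define y where "y = real (card I) * r"
  have "exp y * (S * (1 - y) + y) = (\<Sum>i\<in>I. exp y * (1 + r / \<alpha> i - y) * \<alpha> i)"
  proof -
    have "(\<Sum>i\<in>I. exp y * (1 + r / \<alpha> i - y) * \<alpha> i) = (\<Sum>i\<in>I. exp y * (\<alpha> i * (1 - y) + r))"
      using pos by (intro sum.cong refl) (force simp: field_simps)
    also have "\<dots> = exp y * (S * (1 - y) + y)"
      by (simp add: S_def y_def sum.distrib flip: sum_distrib_left sum_distrib_right)
    finally show ?thesis by simp
  qed
  also have "\<dots> \<le> (\<Sum>i\<in>I. exp (r / \<alpha> i) * \<alpha> i)"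
    using pos by (intro sum_mono mult_right_mono exp_above_tangent) (auto simp: less_imp_le)
  finally have "exp y * (S * (1 - y) + y) \<le> (\<Sum>i\<in>I. exp (r / \<alpha> i) * \<alpha> i)" .
  \<comment> \<open>The missing mass: the same tangent evaluated at 0, where \<open>exp\<close>
    equals 1.\<close>
  moreover have "(1 - S) * (exp y * (1 - y)) \<le> (1 - S) * 1"
    using exp_above_tangent[of y 0] assms(3) by (intro mult_left_mono) (auto simp: S_def)
  ultimately have "exp y - 1 \<le> (\<Sum>i\<in>I. exp (r / \<alpha> i) * \<alpha> i) - S"
    by (simp add: algebra_simps)
  then show ?thesis
    by (simp add: S_def y_def left_diff_distrib sum_subtractf)
qed

text \<open>Telescoping, by downward induction: the summand at \<open>j\<close> is
  \<open>exp ((K - j + 1) * r) - exp ((K - j) * r)\<close>. The base \<open>m = Suc K\<close> is the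
  empty tail.\<close>

lemma noma_coefficient_tail:
  fixes r :: real
  assumes "m \<le> Suc K"
  shows "(\<Sum>j=m..K. (exp r - 1) * exp (real (K - j) * r)) = exp (real (Suc K - m) * r) - 1"
  using assms
proof (induction m rule: inc_induct)
  case (step n)
  then have "real (Suc K - n) = real (K - n) + 1"
    by (simp add: Suc_diff_le)
  then have "exp (real (Suc K - n) * r) = exp r * exp (real (K - n) * r)"
    by (simp only: distrib_right mult_1 exp_add) (rule mult.commute)
  with step show ?case
    by (simp add: sum.atLeast_Suc_atMost left_diff_distrib del: of_nat_diff of_nat_diff_if)
qed simp

text \<open>Downward induction on \<open>m\<close>. Since the tail after \<open>k\<close> is
  nonnegative, lowering its factor from \<open>c (Suc k)\<close> to \<open>c k\<close> can only
  decrease the product, after which the first term merges with the tail.\<close>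

lemma abel_sum_lower_bound:
  fixes c d :: "nat \<Rightarrow> real"
  assumes tail: "\<And>j. m \<le> j \<Longrightarrow> j \<le> n \<Longrightarrow> 0 \<le> sum d {j..n}"
    and mono: "\<And>i j. m \<le> i \<Longrightarrow> i \<le> j \<Longrightarrow> j \<le> n \<Longrightarrow> c i \<le> c j"
    and "m \<le> n"
  shows "c m * sum d {m..n} \<le> (\<Sum>j=m..n. d j * c j)"
  using \<open>m \<le> n\<close> tail mono
proof (induction m rule: inc_induct)
  case (step k)
  have "c k * sum d {Suc k..n} \<le> c (Suc k) * sum d {Suc k..n}"
    using step.hyps by (intro mult_right_mono step.prems) auto
  also have "\<dots> \<le> (\<Sum>j=Suc k..n. d j * c j)"
    using step.prems by (intro step.IH) auto
  finally show ?case
    using step.hyps by (simp add: sum.atLeast_Suc_atMost algebra_simps)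
qed simp

section \<open>NOMA against an arbitrary allocation\<close>

lemma noma_power_reindex:
  assumes "K \<ge> 1"
  shows "noma_power K N0 r h =
    N0 * (\<Sum>j=1..K. (exp r - 1) * exp (real (K - j) * r) * (1 / (cmod (h j))\<^sup>2))"
proof -
  have "(\<Sum>i=0..K-1. exp (real i * r) / (cmod (h (K - i)))\<^sup>2)
      = (\<Sum>j=1..K. exp (real (K - j) * r) / (cmod (h j))\<^sup>2)"
    using assms
    by (intro sum.reindex_bij_witness[of _ "\<lambda>j. K - j" "\<lambda>i. K - i"]) auto
  then show ?thesis
    by (simp add: noma_power_def sum_distrib_left mult_ac)
qed

lemma noma_power_le_oma2_objective:
  assumes "K \<ge> 1" "N0 > 0" and nz: "\<And>i. i \<in> {1..K} \<Longrightarrow> h i \<noteq> 0"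
    and anti: "\<And>i j. 1 \<le> i \<Longrightarrow> i \<le> j \<Longrightarrow> j \<le> K \<Longrightarrow> cmod (h j) \<le> cmod (h i)"
    and alloc: "oma2_allocation K \<alpha>"
  shows "noma_power K N0 r h \<le> oma2_objective K N0 r h \<alpha>"
proof -
  define c where "c = (\<lambda>j. 1 / (cmod (h j))\<^sup>2)"
  define b where "b = (\<lambda>j. (exp r - 1) * exp (real (K - j) * r))"
  define a where "a = (\<lambda>j. (exp (r / \<alpha> j) - 1) * \<alpha> j)"
  have pos: "\<alpha> i > 0" if "i \<in> {1..K}" for i
    using alloc that by (auto simp: oma2_allocation_def)
  have total: "sum \<alpha> {1..K} = 1"
    using alloc by (simp add: oma2_allocation_def)
  have tail: "0 \<le> (\<Sum>i=j..K. a i - b i)" if "1 \<le> j" "j \<le> K" for j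
  proof -
    \<comment> \<open>The users before \<open>j\<close> account for the mass missing from the
      tail.\<close>
    have "sum \<alpha> {j..K} \<le> sum \<alpha> {1..K}"
      using that pos by (intro sum_mono2) (auto simp: less_imp_le)
    then have "exp (real (card {j..K}) * r) - 1 \<le> sum a {j..K}"
      unfolding a_def using that pos total
      by (intro exp_minus_one_le_oma2_sum) auto
    moreover have "sum b {j..K} = exp (real (card {j..K}) * r) - 1"
      unfolding b_def using that by (subst noma_coefficient_tail) auto
    ultimately show ?thesis
      by (simp add: sum_subtractf)
  qed
  have mono: "c i \<le> c j" if "1 \<le> i" "i \<le> j" "j \<le> K" for i j
    unfolding c_def using that nz anti by (intro divide_left_mono power_mono) auto
  have "0 \<le> c 1 * (\<Sum>j=1..K. a j - b j)"
    using tail[of 1] \<open>K \<ge> 1\<close> by (simp add: c_def)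
  also have "\<dots> \<le> (\<Sum>j=1..K. (a j - b j) * c j)"
    using tail mono \<open>K \<ge> 1\<close> by (intro abel_sum_lower_bound)
  finally have "(\<Sum>j=1..K. b j * c j) \<le> (\<Sum>j=1..K. a j * c j)"
    by (simp add: left_diff_distrib sum_subtractf)
  then have "N0 * (\<Sum>j=1..K. b j * c j) \<le> N0 * (\<Sum>j=1..K. a j * c j)"
    using \<open>N0 > 0\<close> by simp
  then show ?thesis
    using noma_power_reindex[OF \<open>K \<ge> 1\<close>, of N0 r h]
    by (simp add: oma2_objective_def a_def b_def c_def)
qed

section \<open>The uniform allocation\<close>

lemma oma2_allocation_uniform:
  assumes "K \<ge> 1"
  shows "oma2_allocation K (\<lambda>_. 1 / real K)"
  using assms by (simp add: oma2_allocation_def)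

lemma oma2_objective_uniform:
  assumes "K \<ge> 1"
  shows "oma2_objective K N0 r h (\<lambda>_. 1 / real K) = oma1_power K N0 r h"
  using assms by (simp add: oma2_objective_def oma1_power_def sum_distrib_left mult_ac)

section \<open>Attainment of the minimum\<close>

lemma oma2_objective_cong:
  assumes "\<And>i. i \<in> {1..K} \<Longrightarrow> \<alpha> i = \<beta> i"
  shows "oma2_objective K N0 r h \<alpha> = oma2_objective K N0 r h \<beta>"
  using assms by (simp add: oma2_objective_def)

text \<open>One summand already blows up as its share tends to 0. The Taylor bound must reach second
  order: the linear term contributes only \<open>r / \<alpha> i * \<alpha> i = r\<close>, which
  stays bounded.\<close>

lemma oma2_objective_ge:
  assumes "N0 > 0" "r \<ge> 0" and pos: "\<And>i. i \<in> {1..K} \<Longrightarrow> \<alpha> i > 0" and "i \<in> {1..K}"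
  shows "N0 * (r\<^sup>2 / (2 * \<alpha> i) / (cmod (h i))\<^sup>2) \<le> oma2_objective K N0 r h \<alpha>"
proof -
  have "r\<^sup>2 / (2 * \<alpha> i) \<le> (r / \<alpha> i + (r / \<alpha> i)\<^sup>2 / 2) * \<alpha> i"
    using pos[OF \<open>i \<in> {1..K}\<close>] \<open>r \<ge> 0\<close> by (simp add: field_simps power2_eq_square)
  also have "\<dots> \<le> (exp (r / \<alpha> i) - 1) * \<alpha> i"
    using exp_lower_Taylor_quadratic[of "r / \<alpha> i"] pos[OF \<open>i \<in> {1..K}\<close>] \<open>r \<ge> 0\<close>
    by (intro mult_right_mono) auto
  finally have "r\<^sup>2 / (2 * \<alpha> i) / (cmod (h i))\<^sup>2 \<le> (exp (r / \<alpha> i) - 1) * \<alpha> i / (cmod (h i))\<^sup>2"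
    by (intro divide_right_mono) auto
  also have "\<dots> \<le> (\<Sum>j=1..K. (exp (r / \<alpha> j) - 1) * \<alpha> j / (cmod (h j))\<^sup>2)"
    using assms by (intro member_le_sum) (auto simp: less_imp_le)
  finally show ?thesis
    unfolding oma2_objective_def using \<open>N0 > 0\<close> by (intro mult_left_mono) auto
qed

lemma oma2_objective_sublevel_bounded_below:
  assumes "N0 > 0" "r > 0" and nz: "\<And>i. i \<in> {1..K} \<Longrightarrow> h i \<noteq> 0"
  obtains \<epsilon> where "\<epsilon> > 0"
    and "\<And>\<alpha> i. oma2_allocation K \<alpha> \<Longrightarrow> oma2_objective K N0 r h \<alpha> \<le> M \<Longrightarrow> i \<in> {1..K} \<Longrightarrow> \<epsilon> \<le> \<alpha> i"
proof
  \<comment> \<open>\<open>B\<close> and \<open>H\<close> are positive upper bounds for the level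
    \<open>M\<close> and for every squared modulus, so that one \<epsilon> serves all users. The
    summand 1 keeps \<open>H\<close> positive even for an empty sum.\<close>
  define B where "B = max M 1"
  define H where "H = (\<Sum>i=1..K. (cmod (h i))\<^sup>2) + 1"
  have "B > 0" "M \<le> B"
    by (auto simp: B_def)
  have "H > 0"
    unfolding H_def by (intro add_nonneg_pos sum_nonneg) auto
  show "N0 * r\<^sup>2 / (2 * B * H) > 0"
    using assms \<open>B > 0\<close> \<open>H > 0\<close> by simp
  fix \<alpha> i
  assume alloc: "oma2_allocation K \<alpha>" and "oma2_objective K N0 r h \<alpha> \<le> M" and i: "i \<in> {1..K}"
  have pos: "\<And>i. i \<in> {1..K} \<Longrightarrow> \<alpha> i > 0"
    using alloc by (simp add: oma2_allocation_def)
  have "(cmod (h i))\<^sup>2 \<le> (\<Sum>i=1..K. (cmod (h i))\<^sup>2)"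
    using i by (intro member_le_sum) auto
  then have hi: "(cmod (h i))\<^sup>2 \<le> H"
    by (simp add: H_def)
  have "N0 * (r\<^sup>2 / (2 * \<alpha> i) / (cmod (h i))\<^sup>2) \<le> oma2_objective K N0 r h \<alpha>"
    using \<open>N0 > 0\<close> \<open>r > 0\<close> pos i by (intro oma2_objective_ge) auto
  also have "\<dots> \<le> B"
    using \<open>oma2_objective K N0 r h \<alpha> \<le> M\<close> \<open>M \<le> B\<close> by simp
  finally have "N0 * r\<^sup>2 \<le> B * (2 * \<alpha> i * (cmod (h i))\<^sup>2)"
    using pos[OF i] nz[OF i] by (simp add: field_simps)
  also have "\<dots> \<le> B * (2 * \<alpha> i * H)"
    using \<open>B > 0\<close> pos[OF i] hi by (intro mult_left_mono) auto
  finally show "N0 * r\<^sup>2 / (2 * B * H) \<le> \<alpha> i"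
    using \<open>B > 0\<close> \<open>H > 0\<close> by (simp add: field_simps)
qed

text \<open>Tychonoff's theorem, stated for functions with the product topology.\<close>

lemma compact_Pi_UNIV:
  fixes C :: "'a \<Rightarrow> 'b::topological_space set"
  assumes "\<And>i. compact (C i)"
  shows "compact {x. \<forall>i. x i \<in> C i}"
proof -
  have "compactin (product_topology (\<lambda>i. euclidean) UNIV) (PiE UNIV C)"
    using assms by (subst compactin_PiE) (auto simp: compactin_euclidean_iff)
  moreover have "PiE UNIV C = {x. \<forall>i. x i \<in> C i}"
    by (auto simp: PiE_def)
  ultimately show ?thesis
    by (simp add: euclidean_product_topology compactin_euclidean_iff)
qed

lemma oma2_objective_attains_min:
  assumes "K \<ge> 1" "N0 > 0" "r \<ge> 0" and nz: "\<And>i. i \<in> {1..K} \<Longrightarrow> h i \<noteq> 0"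
  shows "\<exists>\<alpha>. is_arg_min (oma2_objective K N0 r h) (oma2_allocation K) \<alpha>"
proof (cases "r = 0")
  case True
  \<comment> \<open>At rate 0 the objective vanishes identically, so any allocation is a
    minimizer.\<close>
  then have "is_arg_min (oma2_objective K N0 r h) (oma2_allocation K) (\<lambda>_. 1 / real K)"
    using oma2_allocation_uniform[OF \<open>K \<ge> 1\<close>] by (simp add: is_arg_min_def oma2_objective_def)
  then show ?thesis by blast
next
  case False
  with \<open>r \<ge> 0\<close> have "r > 0" by simp
  define u :: "nat \<Rightarrow> real" where "u = (\<lambda>i. if i \<in> {1..K} then 1 / real K else 0)"
  let ?f = "oma2_objective K N0 r h"
  \<comment> \<open>The level of the uniform allocation \<open>u\<close> serves as cutoff: its
    sublevel set contains \<open>u\<close>, and there all shares are at least \<epsilon>.\<close>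
  obtain \<epsilon> where "\<epsilon> > 0" and
    \<epsilon>: "\<And>\<alpha> i. oma2_allocation K \<alpha> \<Longrightarrow> ?f \<alpha> \<le> ?f u \<Longrightarrow> i \<in> {1..K} \<Longrightarrow> \<epsilon> \<le> \<alpha> i"
    by (rule oma2_objective_sublevel_bounded_below[OF \<open>N0 > 0\<close> \<open>r > 0\<close> nz, where M = "?f u"]) auto
  have u: "oma2_allocation K u"
    using \<open>K \<ge> 1\<close> by (simp add: oma2_allocation_def u_def)
  \<comment> \<open>Coordinates outside \<open>{1..K}\<close> are pinned to \<open>0\<close> to make the set compact in the product topology.\<close>
  define C where "C = {\<alpha>. \<forall>i. \<alpha> i \<in> (if i \<in> {1..K} then {\<epsilon>..1} else {0})}
    \<inter> {\<alpha>. (\<Sum>i=1..K. \<alpha> i) = (1::real)}"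
  have in_C: "(\<lambda>i. if i \<in> {1..K} then \<alpha> i else 0) \<in> C"
    if "oma2_allocation K \<alpha>" "?f \<alpha> \<le> ?f u" for \<alpha>
  proof -
    have "\<alpha> i \<le> 1" if "i \<in> {1..K}" for i
    proof -
      have "\<alpha> i \<le> (\<Sum>i=1..K. \<alpha> i)"
        using that \<open>oma2_allocation K \<alpha>\<close>
        by (intro member_le_sum) (auto simp: oma2_allocation_def less_imp_le)
      then show ?thesis
        using \<open>oma2_allocation K \<alpha>\<close> by (simp add: oma2_allocation_def)
    qed
    then show ?thesis
      using that \<epsilon>[OF that] by (auto simp: C_def oma2_allocation_def)
  qed
  have alloc: "oma2_allocation K \<alpha>" if "\<alpha> \<in> C" for \<alpha>
    unfolding oma2_allocation_def
  proof (intro conjI ballI)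
    fix i assume "i \<in> {1..K}"
    with that have "\<epsilon> \<le> \<alpha> i"
      by (auto simp: C_def split: if_splits)
    with \<open>\<epsilon> > 0\<close> show "\<alpha> i > 0" by simp
  qed (use that in \<open>simp add: C_def\<close>)
  have "compact C"
    unfolding C_def
    by (intro compact_Int_closed compact_Pi_UNIV closed_Collect_eq continuous_intros) auto
  moreover have "C \<noteq> {}"
    using in_C[OF u] by auto
  moreover have "continuous_on C ?f"
  proof -
    have "continuous_on C (\<lambda>\<alpha>. \<alpha> i)" for i
      by (intro continuous_on_subset[OF continuous_on_product_coordinates]) auto
    \<comment> \<open>Continuity of \<open>r / \<alpha> i\<close> requires the shares to stay off
      0.\<close>
    moreover have "\<alpha> i \<noteq> 0" if "\<alpha> \<in> C" "i \<in> {1..K}" for \<alpha> i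
      using alloc[OF that(1)] that(2) by (force simp: oma2_allocation_def)
    ultimately show ?thesis
      unfolding oma2_objective_def using nz by (intro continuous_intros) auto
  qed
  ultimately obtain \<alpha> where "\<alpha> \<in> C" and min: "\<And>\<beta>. \<beta> \<in> C \<Longrightarrow> ?f \<alpha> \<le> ?f \<beta>"
    using continuous_attains_inf[of C ?f] by auto
  have restrict: "?f (\<lambda>i. if i \<in> {1..K} then \<beta> i else 0) = ?f \<beta>" for \<beta>
    by (rule oma2_objective_cong) simp
  have "?f \<alpha> \<le> ?f \<beta>" if "oma2_allocation K \<beta>" for \<beta>
  \<comment> \<open>A competitor in the sublevel set lies in \<open>C\<close> once its outer
    coordinates are pinned, which leaves the objective unchanged. Any other competitor is worse than
    \<open>u\<close>, hence worse than the minimum over \<open>C\<close>.\<close>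
  proof (cases "?f \<beta> \<le> ?f u")
    case True
    then show ?thesis
      using min[OF in_C[OF that]] by (simp only: restrict)
  next
    case False
    then show ?thesis
      using min[OF in_C[OF u]] unfolding restrict by linarith
  qed
  then have "is_arg_min ?f (oma2_allocation K) \<alpha>"
    using alloc[OF \<open>\<alpha> \<in> C\<close>] by (force simp: is_arg_min_def)
  then show ?thesis by blast
qed

text \<open>Attainment gives \<open>LEAST\<close> its intended value, so bounds on the objective at
  a minimizer carry over to \<open>oma2_power\<close>.\<close>

lemma oma2_power_eq:
  assumes "is_arg_min (oma2_objective K N0 r h) (oma2_allocation K) \<alpha>"
  shows "oma2_power K N0 r h = oma2_objective K N0 r h \<alpha>"
  unfolding oma2_power_def
  using assms by (intro Least_equality) (auto simp: is_arg_min_linorder)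

theorem mainTheorem4:
  fixes K :: nat and N0 r :: real and h :: "nat \<Rightarrow> complex"
  assumes "K \<ge> 1"
    and "N0 > 0"
    and "r \<ge> 0"
    and "\<And>i. i \<in> {1..K} \<Longrightarrow> h i \<noteq> 0"
    and "\<And>i j. 1 \<le> i \<Longrightarrow> i \<le> j \<Longrightarrow> j \<le> K \<Longrightarrow> cmod (h j) \<le> cmod (h i)"
  shows "(\<exists>\<alpha>. is_arg_min (oma2_objective K N0 r h) (oma2_allocation K) \<alpha>)
    \<and> noma_power K N0 r h \<le> oma2_power K N0 r h
    \<and> oma2_power K N0 r h \<le> oma1_power K N0 r h"
proof -
  obtain \<alpha> where \<alpha>: "is_arg_min (oma2_objective K N0 r h) (oma2_allocation K) \<alpha>"
    using oma2_objective_attains_min[of K N0 r h] assms(1-4) by blast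
  have "noma_power K N0 r h \<le> oma2_objective K N0 r h \<alpha>"
    using assms \<alpha> by (intro noma_power_le_oma2_objective) (auto simp: is_arg_min_def)
  moreover have "oma2_objective K N0 r h \<alpha> \<le> oma1_power K N0 r h"
    using \<alpha> oma2_allocation_uniform[OF assms(1)] oma2_objective_uniform[OF assms(1), of N0 r h]
    by (metis is_arg_min_linorder)
  ultimately show ?thesis
    using \<alpha> oma2_power_eq[OF \<alpha>] by auto
qed

end
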